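(* Let $X$ be a set, and $S$ a (not necessarily finite) subset of $\langle X\rangle$. Then there is a unique overlap-free subset $T\subseteq\langle X\rangle\setminus\{1\}$ which is inverse-equivalent to $S$. An element $w\in\langle X\rangle\setminus\{1\}$ belongs to $T$ if and only if it satisfies the following equivalent conditions: (i) $w$ is invertible in $\langle X:\mathbf{i}(S)\rangle$, but is not a product of two elements of $\langle X\rangle\setminus\{1\}$ that are invertible in $\langle X:\mathbf{i}(S)\rangle$. (ii) $w$ is invertible in $\langle X:\mathbf{i}(S)\rangle$, but does not have a proper left divisor in $\langle X\rangle\setminus\{1\}$ that is left invertible in $\langle X:\mathbf{i}(S)\rangle$. (ii$'$) $w$ is invertible in $\langle X:\mathbf{i}(S)\rangle$, but does not have a proper right divisor in $\langle X\rangle\setminus\{1\}$ that is right invertible in $\langle X:\mathbf{i}(S)\rangle$. (iii) There exists a finite subset $S'$ of $S$ such that for all finite $S''$ with $S'\subseteq S''\subseteq S$, $w$ belongs to the (unique) overlap-free subset $T''\subseteq\langle X\rangle\setminus\{1\}$ inverse-equivalent to $S''$.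
   Context: "Inverse" and "invertible" mean two-sided unless modified by "left" or "right". $\langle X\rangle$ is the free monoid on $X$. For $S\subseteq\langle X\rangle$, $\langle X:\mathbf{i}(S)\rangle$ denotes the monoid obtained from $\langle X\rangle$ by universally adjoining a two-sided inverse $\mathbf{i}(w)$ to each $w\in S$, i.e. the monoid presented by generators $X\cup\{\mathbf{i}(w):w\in S\}$ and relations $w\,\mathbf{i}(w)=1=\mathbf{i}(w)\,w$ for $w\in S$. An element of $\langle X\rangle$ is called (left, right) invertible in $\langle X:\mathbf{i}(S)\rangle$ if its image there is. Subsets $S,S'$ of $\langle X\rangle$ are inverse-equivalent if all elements of $S'$ are invertible in $\langle X:\mathbf{i}(S)\rangle$ and all elements of $S$ are invertible in $\langle X:\mathbf{i}(S')\rangle$. A proper left (respectively right) divisor of $w$ in $\langle X\rangle\setminus\{1\}$ is an element $u\neq 1$ such that $w=uv$ (respectively $w=vu$) for some $v\in\langle X\rangle\setminus\{1\}$. Two nonidentity elements of $\langle X\rangle$ (possibly equal) are said to overlap if one of them can be written $ab$ and the other $bc$ with $a,b,c\in\langle X\rangle$, $b\neq 1$, and at most one of $a$ and $c$ equal to $1$. A subset $T\subseteq\langle X\rangle\setminus\{1\}$ is overlap-free if no pair of elements of $T$ (distinct or not) overlap. *)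

theory Defs
  imports "HOL-Algebra.Group"
begin

text \<open>The free monoid on a set \<open>X\<close> is \<open>lists X\<close>, with \<open>@\<close> as
  multiplication and \<open>[]\<close> as the identity.\<close>

text \<open>The least congruence on the free monoid \<open>lists A\<close> containing the relations \<open>R\<close>.\<close>

inductive_set monoid_cong :: "'g set \<Rightarrow> ('g list \<times> 'g list) set \<Rightarrow> ('g list \<times> 'g list) set"
  for A :: "'g set" and R :: "('g list \<times> 'g list) set" where
  rel: "(u, v) \<in> R \<Longrightarrow> u \<in> lists A \<Longrightarrow> v \<in> lists A \<Longrightarrow> (u, v) \<in> monoid_cong A R"
| refl: "u \<in> lists A \<Longrightarrow> (u, u) \<in> monoid_cong A R"
| sym: "(u, v) \<in> monoid_cong A R \<Longrightarrow> (v, u) \<in> monoid_cong A R"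
| trans: "(u, v) \<in> monoid_cong A R \<Longrightarrow> (v, w) \<in> monoid_cong A R \<Longrightarrow> (u, w) \<in> monoid_cong A R"
| mult: "(u, v) \<in> monoid_cong A R \<Longrightarrow> (u', v') \<in> monoid_cong A R
    \<Longrightarrow> (u @ u', v @ v') \<in> monoid_cong A R"

definition presented_monoid :: "'g set \<Rightarrow> ('g list \<times> 'g list) set \<Rightarrow> 'g list set monoid" where
  "presented_monoid A R =
    \<lparr>carrier = lists A // monoid_cong A R,
     mult = (\<lambda>P Q. \<Union>u\<in>P. \<Union>v\<in>Q. monoid_cong A R `` {u @ v}),
     one = monoid_cong A R `` {[]}\<rparr>"

text \<open>\<open>FInv w\<close> is the formal symbol for the adjoined inverse of the whole word \<open>w\<close>;
  it is a single generator.\<close>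

datatype 'a inv_gen = Letter 'a | FInv "'a list"

definition inv_gens :: "'a set \<Rightarrow> 'a list set \<Rightarrow> 'a inv_gen set" where
  "inv_gens X S = Letter ` X \<union> FInv ` S"

definition inv_rels :: "'a list set \<Rightarrow> ('a inv_gen list \<times> 'a inv_gen list) set" where
  "inv_rels S = (\<Union>w\<in>S. {(map Letter w @ [FInv w], []), ([FInv w] @ map Letter w, [])})"

definition adjoin_inverses :: "'a set \<Rightarrow> 'a list set \<Rightarrow> 'a inv_gen list set monoid" where
  "adjoin_inverses X S = presented_monoid (inv_gens X S) (inv_rels S)"

text \<open>The canonical map from \<open>lists X\<close> to \<open>adjoin_inverses X S\<close>, which need not be
  injective.\<close>

definition image_in :: "'a set \<Rightarrow> 'a list set \<Rightarrow> 'a list \<Rightarrow> 'a inv_gen list set" where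
  "image_in X S w = monoid_cong (inv_gens X S) (inv_rels S) `` {map Letter w}"

definition invertible_in :: "'a set \<Rightarrow> 'a list set \<Rightarrow> 'a list \<Rightarrow> bool" where
  "invertible_in X S w \<longleftrightarrow> image_in X S w \<in> Units (adjoin_inverses X S)"

text \<open>Left (right) invertible means having a left (right) inverse.\<close>

definition left_invertible_in :: "'a set \<Rightarrow> 'a list set \<Rightarrow> 'a list \<Rightarrow> bool" where
  "left_invertible_in X S w \<longleftrightarrow>
    (\<exists>y\<in>carrier (adjoin_inverses X S).
      y \<otimes>\<^bsub>adjoin_inverses X S\<^esub> image_in X S w = \<one>\<^bsub>adjoin_inverses X S\<^esub>)"

definition right_invertible_in :: "'a set \<Rightarrow> 'a list set \<Rightarrow> 'a list \<Rightarrow> bool" where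
  "right_invertible_in X S w \<longleftrightarrow>
    (\<exists>y\<in>carrier (adjoin_inverses X S).
      image_in X S w \<otimes>\<^bsub>adjoin_inverses X S\<^esub> y = \<one>\<^bsub>adjoin_inverses X S\<^esub>)"

definition inverse_equivalent :: "'a set \<Rightarrow> 'a list set \<Rightarrow> 'a list set \<Rightarrow> bool" where
  "inverse_equivalent X S S' \<longleftrightarrow>
    (\<forall>w\<in>S'. invertible_in X S w) \<and> (\<forall>w\<in>S. invertible_in X S' w)"

definition proper_left_divisor :: "'a set \<Rightarrow> 'a list \<Rightarrow> 'a list \<Rightarrow> bool" where
  "proper_left_divisor X u w \<longleftrightarrow>
    u \<in> lists X - {[]} \<and> (\<exists>v \<in> lists X - {[]}. w = u @ v)"

definition proper_right_divisor :: "'a set \<Rightarrow> 'a list \<Rightarrow> 'a list \<Rightarrow> bool" where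
  "proper_right_divisor X u w \<longleftrightarrow>
    u \<in> lists X - {[]} \<and> (\<exists>v \<in> lists X - {[]}. w = v @ u)"

definition overlap :: "'a set \<Rightarrow> 'a list \<Rightarrow> 'a list \<Rightarrow> bool" where
  "overlap X u v \<longleftrightarrow>
    (\<exists>a\<in>lists X. \<exists>b\<in>lists X. \<exists>c\<in>lists X. b \<noteq> [] \<and> \<not> (a = [] \<and> c = []) \<and>
      (u = a @ b \<and> v = b @ c \<or> v = a @ b \<and> u = b @ c))"

text \<open>Pairs with \<open>u = v\<close> are included, so no word of \<open>T\<close> may overlap itself.\<close>

definition overlap_free :: "'a set \<Rightarrow> 'a list set \<Rightarrow> bool" where
  "overlap_free X T \<longleftrightarrow> T \<subseteq> lists X - {[]} \<and> (\<forall>u\<in>T. \<forall>v\<in>T. \<not> overlap X u v)"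

end

(* The words invertible in <X : i(S)> are closed under products, and if ab and bc are invertible,
   then b is invertible on both sides, hence so are a and c. The set of irreducible invertible
   words is therefore overlap-free, and it generates all invertible words, which makes it
   inverse-equivalent to S.

   For uniqueness, let T be overlap-free. The rules t i(t) -> 1 and i(t) t -> 1 (t in T) have only
   trivial ambiguities, so <X : i(T)> acts on the reduced words by appending a generator and
   cancelling. If y u = 1 with u a nonempty word on X, the letters of u must cancel against the
   reduced form of y, which requires a redex i(t) t straddling the two: a nonempty prefix of u is a
   suffix of some t in T. Applied to the factors of an element of T, this shows that T consists of
   irreducible invertible words; applied to an irreducible invertible word, it yields an overlap
   with an element of T, hence equality with it. *)

theory Submission
  imports Defs
begin

(* Otherwise auto splits membership in lists into statements about the elements. *)
declare in_listsD [rule del] in_listsI [rule del]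

section \<open>Congruences on free monoids\<close>

lemma monoid_cong_lists: "(u, v) \<in> monoid_cong A R \<Longrightarrow> u \<in> lists A \<and> v \<in> lists A"
  by (induction rule: monoid_cong.induct) auto

lemma equiv_monoid_cong: "equiv (lists A) (monoid_cong A R)"
proof (rule equivI)
  show "monoid_cong A R \<subseteq> lists A \<times> lists A"
    using monoid_cong_lists by fast
  show "refl_on (lists A) (monoid_cong A R)"
    by (auto simp: refl_on_def intro: monoid_cong.refl)
  show "sym (monoid_cong A R)"
    by (auto simp: sym_def intro: monoid_cong.sym)
  show "trans (monoid_cong A R)"
    by (auto simp: trans_def intro: monoid_cong.trans)
qed

lemma monoid_cong_mono:
  assumes "(u, v) \<in> monoid_cong A R" "A \<subseteq> B" "R \<subseteq> Q"
  shows "(u, v) \<in> monoid_cong B Q"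
  using assms
proof (induction rule: monoid_cong.induct)
  case (rel u v)
  then show ?case
    using lists_mono by (intro monoid_cong.rel) blast+
next
  case (refl u)
  then show ?case
    using lists_mono by (intro monoid_cong.refl) blast
qed (auto intro: monoid_cong.sym monoid_cong.trans monoid_cong.mult)

lemma monoid_cong_delete:
  assumes "(r, []) \<in> monoid_cong A R" "a \<in> lists A" "b \<in> lists A"
  shows "(a @ r @ b, a @ b) \<in> monoid_cong A R"
proof -
  have "(r @ b, [] @ b) \<in> monoid_cong A R"
    by (intro monoid_cong.mult assms monoid_cong.refl)
  then show ?thesis
    using assms by (auto intro: monoid_cong.mult monoid_cong.refl)
qed

text \<open>Together with its converse below, this is the form in which all computations with
  inverses are done: a factor congruent to \<open>[]\<close> is removed from, or put into, a word
  congruent to \<open>[]\<close>.\<close>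

lemma monoid_cong_delete_Nil:
  assumes "(r, []) \<in> monoid_cong A R" "a \<in> lists A" "b \<in> lists A"
    and "(a @ b, []) \<in> monoid_cong A R"
  shows "(a @ r @ b, []) \<in> monoid_cong A R"
  by (rule monoid_cong.trans [OF monoid_cong_delete [OF assms(1-3)] assms(4)])

lemma monoid_cong_insert_Nil:
  assumes "(r, []) \<in> monoid_cong A R" "a \<in> lists A" "b \<in> lists A"
    and "(a @ r @ b, []) \<in> monoid_cong A R"
  shows "(a @ b, []) \<in> monoid_cong A R"
  by (rule monoid_cong.trans [OF monoid_cong.sym [OF monoid_cong_delete [OF assms(1-3)]] assms(4)])

text \<open>The word \<open>w @ y @ w @ z\<close> collapses to \<open>w @ z\<close> when the middle
  \<open>y @ w\<close> is deleted, and to \<open>w @ y\<close> when the final \<open>w @ z\<close>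
  is deleted.\<close>

lemma monoid_cong_left_right_inverse:
  assumes "(y @ w, []) \<in> monoid_cong A R" "(w @ z, []) \<in> monoid_cong A R"
  shows "(w @ y, []) \<in> monoid_cong A R"
proof -
  have lists: "y \<in> lists A" "w \<in> lists A" "z \<in> lists A"
    using monoid_cong_lists assms by (metis append_in_lists_conv)+
  have "((w @ y) @ (w @ z) @ [], []) \<in> monoid_cong A R"
    using monoid_cong_delete_Nil [of "y @ w" A R w z] assms lists by simp
  then show ?thesis
    using monoid_cong_insert_Nil [of "w @ z" A R "w @ y" "[]"] assms lists by simp
qed

text \<open>The universal property of a presentation: the homomorphism of free monoids extending
  \<open>h\<close> descends to the presented monoids as soon as it respects the defining
  relations.\<close>

lemma monoid_cong_subst:
  assumes "(u, v) \<in> monoid_cong A R"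
    and gens: "\<And>g. g \<in> A \<Longrightarrow> h g \<in> lists B"
    and rels: "\<And>u v. (u, v) \<in> R \<Longrightarrow> (concat (map h u), concat (map h v)) \<in> monoid_cong B Q"
  shows "(concat (map h u), concat (map h v)) \<in> monoid_cong B Q"
  using assms(1)
proof (induction rule: monoid_cong.induct)
  case (rel u v)
  then show ?case
    by (intro rels)
next
  case (refl u)
  then show ?case
    by (intro monoid_cong.refl, induction u) (use gens in auto)
next
  case (mult u v u' v')
  then show ?case
    by (simp add: monoid_cong.mult)
qed (auto intro: monoid_cong.sym monoid_cong.trans)

section \<open>Computing in a presented monoid with representing words\<close>

lemma presented_monoid_mult:
  assumes "u \<in> lists A" "v \<in> lists A"
  shows "monoid_cong A R `` {u} \<otimes>\<^bsub>presented_monoid A R\<^esub> monoid_cong A R `` {v}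
    = monoid_cong A R `` {u @ v}"
proof -
  have "(\<Union>u' \<in> monoid_cong A R `` {u}. \<Union>v' \<in> monoid_cong A R `` {v}. monoid_cong A R `` {u' @ v'})
      = (\<Union>u' \<in> monoid_cong A R `` {u}. \<Union>v' \<in> monoid_cong A R `` {v}. monoid_cong A R `` {u @ v})"
  proof (intro SUP_cong HOL.refl)
    fix u' v'
    assume "u' \<in> monoid_cong A R `` {u}" "v' \<in> monoid_cong A R `` {v}"
    then have "(u @ v, u' @ v') \<in> monoid_cong A R"
      by (intro monoid_cong.mult) auto
    then show "monoid_cong A R `` {u' @ v'} = monoid_cong A R `` {u @ v}"
      using equiv_class_eq [OF equiv_monoid_cong] by fastforce
  qed
  also have "\<dots> = monoid_cong A R `` {u @ v}"
    using monoid_cong.refl [OF assms(1)] monoid_cong.refl [OF assms(2)] by blast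
  finally show ?thesis
    by (simp add: presented_monoid_def)
qed

text \<open>Turns an equation with the identity of the quotient into a congruence of words, so that
  inverses can be handled as words from then on.\<close>

lemma presented_monoid_mult_eq_one_iff:
  assumes "u \<in> lists A" "v \<in> lists A"
  shows "monoid_cong A R `` {u} \<otimes>\<^bsub>presented_monoid A R\<^esub> monoid_cong A R `` {v}
      = \<one>\<^bsub>presented_monoid A R\<^esub> \<longleftrightarrow> (u @ v, []) \<in> monoid_cong A R"
proof -
  have "\<one>\<^bsub>presented_monoid A R\<^esub> = monoid_cong A R `` {[]}"
    by (simp add: presented_monoid_def)
  then show ?thesis
    using assms by (simp add: presented_monoid_mult eq_equiv_class_iff [OF equiv_monoid_cong])
qed

lemma carrier_presented_monoid:
  "carrier (presented_monoid A R) = (\<lambda>u. monoid_cong A R `` {u}) ` lists A"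
  by (auto simp: presented_monoid_def quotient_def)

section \<open>Invertible words\<close>

abbreviation word_cong :: "'a set \<Rightarrow> 'a list set \<Rightarrow> ('a inv_gen list \<times> 'a inv_gen list) set" where
  "word_cong X S \<equiv> monoid_cong (inv_gens X S) (inv_rels S)"

lemma map_Letter_in_lists [simp]: "map Letter w \<in> lists (inv_gens X S) \<longleftrightarrow> w \<in> lists X"
  by (auto simp: inv_gens_def in_lists_conv_set)

lemma left_invertible_in_iff:
  assumes "w \<in> lists X"
  shows "left_invertible_in X S w \<longleftrightarrow>
    (\<exists>y \<in> lists (inv_gens X S). (y @ map Letter w, []) \<in> word_cong X S)"
  using assms
  by (simp add: left_invertible_in_def adjoin_inverses_def image_in_def carrier_presented_monoid
      presented_monoid_mult_eq_one_iff)

lemma right_invertible_in_iff: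
  assumes "w \<in> lists X"
  shows "right_invertible_in X S w \<longleftrightarrow>
    (\<exists>y \<in> lists (inv_gens X S). (map Letter w @ y, []) \<in> word_cong X S)"
  using assms
  by (simp add: right_invertible_in_def adjoin_inverses_def image_in_def carrier_presented_monoid
      presented_monoid_mult_eq_one_iff)

lemma invertible_in_iff:
  assumes "w \<in> lists X"
  shows "invertible_in X S w \<longleftrightarrow>
    (\<exists>y \<in> lists (inv_gens X S).
      (y @ map Letter w, []) \<in> word_cong X S \<and> (map Letter w @ y, []) \<in> word_cong X S)"
  using assms
  by (auto simp: invertible_in_def Units_def adjoin_inverses_def image_in_def
      carrier_presented_monoid presented_monoid_mult_eq_one_iff)

lemma invertible_in_iff_left_right:
  assumes "w \<in> lists X"
  shows "invertible_in X S w \<longleftrightarrow> left_invertible_in X S w \<and> right_invertible_in X S w"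
  unfolding invertible_in_iff [OF assms] left_invertible_in_iff [OF assms]
    right_invertible_in_iff [OF assms]
  using monoid_cong_left_right_inverse by blast

lemma invertible_in_Nil: "invertible_in X S []"
  by (auto simp: invertible_in_iff intro!: bexI [of _ "[]"] monoid_cong.refl)

lemma invertible_in_adjoined:
  assumes "S \<subseteq> lists X" "w \<in> S"
  shows "invertible_in X S w"
proof -
  have w: "w \<in> lists X"
    using assms by blast
  have "[FInv w] \<in> lists (inv_gens X S)"
    using assms by (simp add: inv_gens_def)
  moreover have "([FInv w] @ map Letter w, []) \<in> inv_rels S" "(map Letter w @ [FInv w], []) \<in> inv_rels S"
    using assms(2) by (auto simp: inv_rels_def)
  ultimately show ?thesis
    unfolding invertible_in_iff [OF w] using w
    by (meson append_in_lists_conv lists.Nil map_Letter_in_lists monoid_cong.rel)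
qed

section \<open>One-sided invertibility of products and factors\<close>

lemma left_invertible_in_append:
  assumes "u \<in> lists X" "v \<in> lists X" "left_invertible_in X S u" "left_invertible_in X S v"
  shows "left_invertible_in X S (u @ v)"
proof -
  obtain y z where yz: "y \<in> lists (inv_gens X S)" "(y @ map Letter u, []) \<in> word_cong X S"
      "z \<in> lists (inv_gens X S)" "(z @ map Letter v, []) \<in> word_cong X S"
    using assms by (auto simp: left_invertible_in_iff)
  then have "(z @ (y @ map Letter u) @ map Letter v, []) \<in> word_cong X S"
    using assms by - (rule monoid_cong_delete_Nil, auto)
  then show ?thesis
    using assms yz by (auto simp: left_invertible_in_iff intro!: bexI [of _ "z @ y"])
qed

lemma right_invertible_in_append:
  assumes "u \<in> lists X" "v \<in> lists X" "right_invertible_in X S u" "right_invertible_in X S v"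
  shows "right_invertible_in X S (u @ v)"
proof -
  obtain y z where yz: "y \<in> lists (inv_gens X S)" "(map Letter u @ y, []) \<in> word_cong X S"
      "z \<in> lists (inv_gens X S)" "(map Letter v @ z, []) \<in> word_cong X S"
    using assms by (auto simp: right_invertible_in_iff)
  then have "(map Letter u @ (map Letter v @ z) @ y, []) \<in> word_cong X S"
    using assms by - (rule monoid_cong_delete_Nil, auto)
  then show ?thesis
    using assms yz by (auto simp: right_invertible_in_iff intro!: bexI [of _ "z @ y"])
qed

lemma left_invertible_in_suffix:
  assumes "u \<in> lists X" "v \<in> lists X" "left_invertible_in X S (u @ v)"
  shows "left_invertible_in X S v"
proof -
  obtain y where "y \<in> lists (inv_gens X S)" "(y @ map Letter (u @ v), []) \<in> word_cong X S"
    using assms by (auto simp: left_invertible_in_iff)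
  then show ?thesis
    using assms by (auto simp: left_invertible_in_iff intro!: bexI [of _ "y @ map Letter u"])
qed

lemma right_invertible_in_prefix:
  assumes "u \<in> lists X" "v \<in> lists X" "right_invertible_in X S (u @ v)"
  shows "right_invertible_in X S u"
proof -
  obtain y where "y \<in> lists (inv_gens X S)" "(map Letter (u @ v) @ y, []) \<in> word_cong X S"
    using assms by (auto simp: right_invertible_in_iff)
  then show ?thesis
    using assms by (auto simp: right_invertible_in_iff intro!: bexI [of _ "map Letter v @ y"])
qed

lemma right_invertible_in_suffix:
  assumes "u \<in> lists X" "v \<in> lists X" "left_invertible_in X S u" "right_invertible_in X S (u @ v)"
  shows "right_invertible_in X S v"
proof -
  obtain y z where yz: "y \<in> lists (inv_gens X S)" "(y @ map Letter u, []) \<in> word_cong X S"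
      "z \<in> lists (inv_gens X S)" "(map Letter (u @ v) @ z, []) \<in> word_cong X S"
    using assms by (auto simp: left_invertible_in_iff right_invertible_in_iff)
  \<comment> \<open>Conjugation: \<open>y u v z u\<close> is \<open>y u\<close>, hence 1. Deleting
    the leading \<open>y u\<close> instead leaves \<open>v z u\<close>, so \<open>z u\<close> is a
    right inverse of \<open>v\<close>.\<close>
  then have "(y @ (map Letter (u @ v) @ z) @ map Letter u, []) \<in> word_cong X S"
    using assms by - (rule monoid_cong_delete_Nil, auto)
  then have "([] @ (y @ map Letter u) @ (map Letter v @ z @ map Letter u), []) \<in> word_cong X S"
    by simp
  then have "([] @ (map Letter v @ z @ map Letter u), []) \<in> word_cong X S"
    using assms yz by - (rule monoid_cong_insert_Nil [OF yz(2)], auto)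
  then show ?thesis
    using assms yz by (auto simp: right_invertible_in_iff intro!: bexI [of _ "z @ map Letter u"])
qed

lemma left_invertible_in_prefix:
  assumes "u \<in> lists X" "v \<in> lists X" "right_invertible_in X S v" "left_invertible_in X S (u @ v)"
  shows "left_invertible_in X S u"
proof -
  obtain y z where yz: "y \<in> lists (inv_gens X S)" "(map Letter v @ y, []) \<in> word_cong X S"
      "z \<in> lists (inv_gens X S)" "(z @ map Letter (u @ v), []) \<in> word_cong X S"
    using assms by (auto simp: left_invertible_in_iff right_invertible_in_iff)
  then have "(map Letter v @ (z @ map Letter (u @ v)) @ y, []) \<in> word_cong X S"
    using assms by - (rule monoid_cong_delete_Nil, auto)
  then have "((map Letter v @ z @ map Letter u) @ (map Letter v @ y) @ [], []) \<in> word_cong X S"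
    by simp
  then have "((map Letter v @ z @ map Letter u) @ [], []) \<in> word_cong X S"
    using assms yz by - (rule monoid_cong_insert_Nil [OF yz(2)], auto)
  then show ?thesis
    using assms yz by (auto simp: left_invertible_in_iff intro!: bexI [of _ "map Letter v @ z"])
qed

lemma invertible_in_append:
  assumes "u \<in> lists X" "v \<in> lists X" "invertible_in X S u" "invertible_in X S v"
  shows "invertible_in X S (u @ v)"
  using assms left_invertible_in_append [of u X v] right_invertible_in_append [of u X v]
  by (simp add: invertible_in_iff_left_right)

text \<open>In an invertible product \<open>u\<close> is right invertible as a prefix, so left
  invertibility makes it a unit; the cofactor is then a unit too. This is what links one-sided
  divisors to factorizations into invertible words.\<close>

lemma invertible_in_factors_left:
  assumes "u \<in> lists X" "v \<in> lists X" "invertible_in X S (u @ v)" "left_invertible_in X S u"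
  shows "invertible_in X S u" "invertible_in X S v"
  using assms left_invertible_in_suffix [of u X v] right_invertible_in_prefix [of u X v]
    right_invertible_in_suffix [of u X v]
  by (auto simp: invertible_in_iff_left_right)

lemma invertible_in_factors_right:
  assumes "u \<in> lists X" "v \<in> lists X" "invertible_in X S (u @ v)" "right_invertible_in X S v"
  shows "invertible_in X S u" "invertible_in X S v"
  using assms left_invertible_in_suffix [of u X v] right_invertible_in_prefix [of u X v]
    left_invertible_in_prefix [of u X v]
  by (auto simp: invertible_in_iff_left_right)

text \<open>Choosing for each \<open>s\<close> a word \<open>j s\<close> inverse to it over
  \<open>S'\<close> and sending \<open>FInv s\<close> to \<open>j s\<close> gives a homomorphism
  that fixes the letters; it carries an inverse of \<open>w\<close> to an inverse of
  \<open>w\<close>.\<close>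

lemma invertible_in_transfer:
  assumes w: "w \<in> lists X" and S: "S \<subseteq> lists X"
    and inv: "\<forall>s \<in> S. invertible_in X S' s" and "invertible_in X S w"
  shows "invertible_in X S' w"
proof -
  have "\<forall>s \<in> S. \<exists>y \<in> lists (inv_gens X S').
      (y @ map Letter s, []) \<in> word_cong X S' \<and> (map Letter s @ y, []) \<in> word_cong X S'"
    using inv S by (metis invertible_in_iff subsetD)
  then obtain j where j: "\<And>s. s \<in> S \<Longrightarrow> j s \<in> lists (inv_gens X S')"
      "\<And>s. s \<in> S \<Longrightarrow> (j s @ map Letter s, []) \<in> word_cong X S'"
      "\<And>s. s \<in> S \<Longrightarrow> (map Letter s @ j s, []) \<in> word_cong X S'"
    by metis
  define h where "h = case_inv_gen (\<lambda>x. [Letter x]) j"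
  have h_FInv [simp]: "h (FInv s) = j s" for s
    by (simp add: h_def)
  have h_Letter [simp]: "concat (map h (map Letter u)) = map Letter u" for u
    by (induction u) (auto simp: h_def)
  have gens: "h g \<in> lists (inv_gens X S')" if "g \<in> inv_gens X S" for g
    using that j(1) by (auto simp: inv_gens_def h_def)
  have rels: "(concat (map h u), concat (map h v)) \<in> word_cong X S'" if "(u, v) \<in> inv_rels S" for u v
    using that j(2,3) h_Letter by (auto simp: inv_rels_def simp del: map_map)
  obtain y where y: "y \<in> lists (inv_gens X S)"
      "(y @ map Letter w, []) \<in> word_cong X S" "(map Letter w @ y, []) \<in> word_cong X S"
    using assms by (auto simp: invertible_in_iff)
  have "concat (map h y) \<in> lists (inv_gens X S')"
    using y(1) gens by (induction y) auto
  moreover have "(concat (map h y) @ map Letter w, []) \<in> word_cong X S'"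
      "(map Letter w @ concat (map h y), []) \<in> word_cong X S'"
    using monoid_cong_subst [OF y(2) gens rels] monoid_cong_subst [OF y(3) gens rels] h_Letter
    by (simp_all del: map_map)
  ultimately show ?thesis
    using w by (auto simp: invertible_in_iff)
qed

lemma invertible_in_mono:
  assumes "w \<in> lists X" "S \<subseteq> S'" "S' \<subseteq> lists X" "invertible_in X S w"
  shows "invertible_in X S' w"
proof (rule invertible_in_transfer [of w X S])
  show "\<forall>s \<in> S. invertible_in X S' s"
    using assms invertible_in_adjoined by blast
qed (use assms in auto)

section \<open>Dependence on finite subsets of \<open>S\<close>\<close>

lemma inv_gens_mono: "S \<subseteq> S' \<Longrightarrow> inv_gens X S \<subseteq> inv_gens X S'"
  by (auto simp: inv_gens_def)

lemma inv_rels_mono: "S \<subseteq> S' \<Longrightarrow> inv_rels S \<subseteq> inv_rels S'"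
  by (auto simp: inv_rels_def)

lemma word_cong_mono: "(u, v) \<in> word_cong X S \<Longrightarrow> S \<subseteq> S' \<Longrightarrow> (u, v) \<in> word_cong X S'"
  by (rule monoid_cong_mono [OF _ inv_gens_mono inv_rels_mono])

lemma lists_inv_gens_finite:
  assumes "u \<in> lists (inv_gens X S)"
  shows "\<exists>F. finite F \<and> F \<subseteq> S \<and> u \<in> lists (inv_gens X F)"
proof (intro exI conjI)
  let ?F = "{s \<in> S. FInv s \<in> set u}"
  show "finite ?F"
    by (rule finite_subset [of _ "FInv -` set u"]) (auto intro: finite_vimageI injI)
  show "u \<in> lists (inv_gens X ?F)"
    using assms by (auto simp: inv_gens_def in_lists_conv_set)
qed auto

text \<open>A derivation uses finitely many relations. Its words must also be words over the smaller
  generating set, so the formal inverses occurring in them are collected as well.\<close>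

lemma word_cong_finite:
  assumes "(u, v) \<in> word_cong X S"
  shows "\<exists>F. finite F \<and> F \<subseteq> S \<and> (u, v) \<in> word_cong X F"
  using assms
proof (induction rule: monoid_cong.induct)
  case (rel u v)
  then obtain s where s: "s \<in> S" "(u, v) \<in> inv_rels {s}"
    by (auto simp: inv_rels_def)
  obtain F G where F: "finite F" "F \<subseteq> S" "u \<in> lists (inv_gens X F)"
      and G: "finite G" "G \<subseteq> S" "v \<in> lists (inv_gens X G)"
    using rel lists_inv_gens_finite by metis
  let ?F = "insert s (F \<union> G)"
  have "(u, v) \<in> word_cong X ?F"
  proof (rule monoid_cong.rel)
    show "(u, v) \<in> inv_rels ?F"
      using s inv_rels_mono [of "{s}" ?F] by auto
    show "u \<in> lists (inv_gens X ?F)"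
      using F(3) lists_mono [OF inv_gens_mono [of F ?F X]] by auto
    show "v \<in> lists (inv_gens X ?F)"
      using G(3) lists_mono [OF inv_gens_mono [of G ?F X]] by auto
  qed
  then show ?case
    using F G s by (intro exI [of _ ?F]) auto
next
  case (refl u)
  then show ?case
    using lists_inv_gens_finite monoid_cong.refl by metis
next
  case (sym u v)
  then show ?case
    using monoid_cong.sym by metis
next
  case (trans u v w)
  then obtain F G where "finite F" "F \<subseteq> S" "(u, v) \<in> word_cong X F"
      "finite G" "G \<subseteq> S" "(v, w) \<in> word_cong X G"
    by blast
  then show ?case
    by (intro exI [of _ "F \<union> G"]) (auto intro: monoid_cong.trans word_cong_mono)
next
  case (mult u v u' v')
  then obtain F G where "finite F" "F \<subseteq> S" "(u, v) \<in> word_cong X F"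
      "finite G" "G \<subseteq> S" "(u', v') \<in> word_cong X G"
    by blast
  then show ?case
    by (intro exI [of _ "F \<union> G"]) (auto intro: monoid_cong.mult word_cong_mono)
qed

lemma invertible_in_finite:
  assumes "w \<in> lists X" "invertible_in X S w"
  shows "\<exists>F. finite F \<and> F \<subseteq> S \<and> invertible_in X F w"
proof -
  obtain y where "(y @ map Letter w, []) \<in> word_cong X S" "(map Letter w @ y, []) \<in> word_cong X S"
    using assms by (auto simp: invertible_in_iff)
  then obtain F G where FG: "finite F" "F \<subseteq> S" "(y @ map Letter w, []) \<in> word_cong X F"
      "finite G" "G \<subseteq> S" "(map Letter w @ y, []) \<in> word_cong X G"
    using word_cong_finite by meson
  then have *: "(y @ map Letter w, []) \<in> word_cong X (F \<union> G)"
      "(map Letter w @ y, []) \<in> word_cong X (F \<union> G)"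
    by (auto intro: word_cong_mono)
  \<comment> \<open>A congruence relates only words over its own generators, so it already confines
    \<open>y\<close> to the formal inverses from \<open>F\<close> and \<open>G\<close>.\<close>
  then have "y \<in> lists (inv_gens X (F \<union> G))"
    using monoid_cong_lists by (metis append_in_lists_conv)
  then have "invertible_in X (F \<union> G) w"
    using * assms by (auto simp: invertible_in_iff)
  then show ?thesis
    using FG by (intro exI [of _ "F \<union> G"]) auto
qed

section \<open>Irreducible invertible words\<close>

text \<open>Condition (i), taken as the candidate for the overlap-free set: these are the atoms of
  the submonoid of invertible words.\<close>

definition irreducible_invertibles :: "'a set \<Rightarrow> 'a list set \<Rightarrow> 'a list set" where
  "irreducible_invertibles X S =
    {w \<in> lists X - {[]}. invertible_in X S w \<and>
      \<not> (\<exists>u \<in> lists X - {[]}. \<exists>v \<in> lists X - {[]}.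
           invertible_in X S u \<and> invertible_in X S v \<and> w = u @ v)}"

lemma irreducible_invertiblesD:
  assumes "w \<in> irreducible_invertibles X S" "w = u @ v" "u \<in> lists X" "v \<in> lists X"
    and "invertible_in X S u" "invertible_in X S v"
  shows "u = [] \<or> v = []"
  using assms unfolding irreducible_invertibles_def by blast

lemma irreducible_invertibles_overlap_eq:
  assumes ab: "a @ b \<in> irreducible_invertibles X S" and bc: "b @ c \<in> irreducible_invertibles X S"
    and "b \<noteq> []"
  shows "a = [] \<and> c = []"
proof -
  have lists: "a \<in> lists X" "b \<in> lists X" "c \<in> lists X"
    and inv: "invertible_in X S (a @ b)" "invertible_in X S (b @ c)"
    using ab bc by (auto simp: irreducible_invertibles_def)
  \<comment> \<open>\<open>b\<close> is a suffix of one invertible word and a prefix of another.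
    Splitting it off each of them leaves invertible cofactors \<open>a\<close> and \<open>c\<close>,
    which irreducibility forces to be empty.\<close>
  have "left_invertible_in X S b" "right_invertible_in X S b"
    using inv lists left_invertible_in_suffix [of a X b] right_invertible_in_prefix [of b X c]
    by (auto simp: invertible_in_iff_left_right)
  then have "invertible_in X S a" "invertible_in X S b" "invertible_in X S c"
    using invertible_in_factors_left(2) [of b X c] invertible_in_factors_right [of a X b] inv lists
    by auto
  then show ?thesis
    using irreducible_invertiblesD ab bc lists \<open>b \<noteq> []\<close> by blast
qed

lemma overlap_free_irreducible_invertibles: "overlap_free X (irreducible_invertibles X S)"
  unfolding overlap_free_def
proof (intro conjI ballI notI)
  show "irreducible_invertibles X S \<subseteq> lists X - {[]}"
    by (auto simp: irreducible_invertibles_def)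
  fix u v
  assume "u \<in> irreducible_invertibles X S" "v \<in> irreducible_invertibles X S" "overlap X u v"
  then show False
    unfolding overlap_def using irreducible_invertibles_overlap_eq by blast
qed

text \<open>By induction on length: an invertible word that is neither empty nor irreducible splits
  into two shorter invertible words.\<close>

lemma invertible_in_irreducible_invertibles:
  assumes "w \<in> lists X" "invertible_in X S w"
  shows "invertible_in X (irreducible_invertibles X S) w"
  using assms
proof (induction w rule: length_induct)
  case (1 w)
  let ?T = "irreducible_invertibles X S"
  have T: "?T \<subseteq> lists X"
    by (auto simp: irreducible_invertibles_def)
  consider "w = []" | "w \<in> ?T"
    | u v where "u \<in> lists X - {[]}" "v \<in> lists X - {[]}"
        "invertible_in X S u" "invertible_in X S v" "w = u @ v"
    using 1 unfolding irreducible_invertibles_def by blast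
  then show ?case
  proof cases
    case 1
    then show ?thesis
      by (simp add: invertible_in_Nil)
  next
    case 2
    then show ?thesis
      by (rule invertible_in_adjoined [OF T])
  next
    case 3
    then have "length u < length w" "length v < length w"
      by auto
    then have "invertible_in X ?T u" "invertible_in X ?T v"
      using 3 "1.IH" by blast+
    then show ?thesis
      using 3 invertible_in_append [of u X v] by blast
  qed
qed

lemma inverse_equivalent_irreducible_invertibles:
  assumes "S \<subseteq> lists X"
  shows "inverse_equivalent X S (irreducible_invertibles X S)"
  unfolding inverse_equivalent_def
proof (intro conjI ballI)
  show "invertible_in X S w" if "w \<in> irreducible_invertibles X S" for w
    using that by (simp add: irreducible_invertibles_def)
  show "invertible_in X (irreducible_invertibles X S) w" if "w \<in> S" for w
    using that assms invertible_in_adjoined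
    by (intro invertible_in_irreducible_invertibles) auto
qed

text \<open>The irreducible invertible words depend only on which words are invertible, and
  inverse-equivalent sets make the same words invertible.\<close>

lemma irreducible_invertibles_eq:
  assumes "S \<subseteq> lists X" "S' \<subseteq> lists X" "inverse_equivalent X S S'"
  shows "irreducible_invertibles X S = irreducible_invertibles X S'"
proof -
  have "invertible_in X S w \<longleftrightarrow> invertible_in X S' w" if "w \<in> lists X" for w
    using that assms invertible_in_transfer unfolding inverse_equivalent_def by metis
  then show ?thesis
    unfolding irreducible_invertibles_def by (intro Collect_cong) blast
qed

section \<open>The action on irreducible words\<close>

definition redexes :: "'a list set \<Rightarrow> 'a inv_gen list set" where
  "redexes T = (\<Union>t \<in> T. {map Letter t @ [FInv t], FInv t # map Letter t})"

definition reduced :: "'a list set \<Rightarrow> 'a inv_gen list \<Rightarrow> bool" where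
  "reduced T n \<longleftrightarrow> \<not> (\<exists>a. \<exists>r \<in> redexes T. \<exists>b. n = a @ r @ b)"

text \<open>One step of a right action on reduced words. Only redexes at the end are considered,
  since appending a generator to a reduced word can create no others. The remainder picked by
  \<open>SOME\<close> is unique by \<open>redexes_suffix_eq\<close>.\<close>

definition act :: "'a list set \<Rightarrow> 'a inv_gen list \<Rightarrow> 'a inv_gen \<Rightarrow> 'a inv_gen list" where
  "act T n g =
    (if \<exists>m. \<exists>r \<in> redexes T. n @ [g] = m @ r
     then (SOME m. \<exists>r \<in> redexes T. n @ [g] = m @ r)
     else n @ [g])"

text \<open>The marker \<open>FInv t\<close> is not a letter, so it cannot lie in the block
  \<open>map Letter q\<close>. It therefore lies in \<open>n\<close>, and the redex straddles the
  boundary.\<close>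

lemma append_Letters_eqD:
  assumes "n @ map Letter q = m @ FInv t # map Letter t"
  shows "\<exists>a. t = a @ q \<and> n = m @ FInv t # map Letter a"
proof -
  from assms consider us where "n = m @ us" "us @ map Letter q = FInv t # map Letter t"
    | us where "n @ us = m" "map Letter q = us @ FInv t # map Letter t"
    by (auto simp: append_eq_append_conv2)
  then show ?thesis
  proof cases
    case 1
    show ?thesis
    proof (cases us)
      case Nil
      with 1 show ?thesis
        by (cases q) auto
    next
      case (Cons g a)
      with 1 have g: "g = FInv t" and eq: "map Letter t = a @ map Letter q"
        by auto
      obtain a' q' where *: "t = a' @ q'" "a = map Letter a'" "map Letter q = map Letter q'"
        using eq by (auto simp: map_eq_append_conv)
      have "q = q'"
        using *(3) by (simp add: inj_map_eq_map inj_def)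
      with * 1(1) Cons g show ?thesis
        by auto
    qed
  next
    case 2
    have "FInv t \<in> set (map Letter q)"
      by (simp only: 2) simp
    then show ?thesis
      by auto
  qed
qed

text \<open>The last symbol determines where the redex starts: a final \<open>FInv s\<close>
  determines \<open>s\<close>, and a final letter leads back to the nearest marker. The two kinds of
  redex agree only for the empty word, which an arbitrary \<open>T\<close> may contain; hence the
  case splits on \<open>[]\<close>.\<close>

lemma redexes_suffix_eq:
  assumes "r \<in> redexes T" "r' \<in> redexes T" "m @ r = m' @ r'"
  shows "m = m'"
proof -
  have eq: "m = m'" if "m @ FInv s # map Letter s = m' @ FInv t # map Letter t" for s t
  proof -
    have "(m @ [FInv s]) @ map Letter s = m' @ FInv t # map Letter t"
      using that by simp
    then obtain a where a: "t = a @ s" "m @ [FInv s] = m' @ FInv t # map Letter a"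
      using append_Letters_eqD by blast
    then show ?thesis
      by (cases a rule: rev_cases) auto
  qed
  have ne: False if "k @ map Letter s @ [FInv s] = k' @ FInv t # map Letter t" "t \<noteq> []" for k k' s t
    using arg_cong [OF that(1), of last] that(2) by (simp add: last_map)
  consider s t where "r = map Letter s @ [FInv s]" "r' = map Letter t @ [FInv t]"
    | s t where "r = FInv s # map Letter s" "r' = FInv t # map Letter t"
    | s t where "r = map Letter s @ [FInv s]" "r' = FInv t # map Letter t"
    | s t where "r = FInv s # map Letter s" "r' = map Letter t @ [FInv t]"
    using assms(1,2) unfolding redexes_def by blast
  then show ?thesis
  proof cases
    case 1
    then show ?thesis
      using assms(3) by auto
  next
    case 2
    then show ?thesis
      using assms(3) eq by blast
  next
    case 3
    then show ?thesis
      using assms(3) ne [of m s m' t] by (cases "t = []") auto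
  next
    case 4
    then show ?thesis
      using assms(3) ne [of m' t m s] by (cases "s = []") auto
  qed
qed

lemma act_redex:
  assumes "r \<in> redexes T" "n @ [g] = m @ r"
  shows "act T n g = m"
proof -
  have "(SOME m. \<exists>r \<in> redexes T. n @ [g] = m @ r) = m"
  proof (rule some_equality)
    show "\<exists>r \<in> redexes T. n @ [g] = m @ r"
      using assms by blast
    show "m' = m" if "\<exists>r \<in> redexes T. n @ [g] = m' @ r" for m'
      using that assms redexes_suffix_eq by metis
  qed
  then show ?thesis
    using assms unfolding act_def by auto
qed

lemma act_no_redex:
  assumes "\<And>m r. r \<in> redexes T \<Longrightarrow> n @ [g] \<noteq> m @ r"
  shows "act T n g = n @ [g]"
  using assms unfolding act_def by auto

lemma reduced_prefix: "reduced T (m @ k) \<Longrightarrow> reduced T m"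
  unfolding reduced_def by (metis append.assoc)

text \<open>A cancellation removes at least the new generator and so leaves a prefix of
  \<open>n\<close>. Without one, a redex in \<open>n @ [g]\<close> would have to end at
  \<open>g\<close> or lie inside \<open>n\<close>.\<close>

lemma reduced_act:
  assumes "reduced T n"
  shows "reduced T (act T n g)"
proof (cases "\<exists>m. \<exists>r \<in> redexes T. n @ [g] = m @ r")
  case True
  then obtain m r where mr: "r \<in> redexes T" "n @ [g] = m @ r"
    by blast
  have "r \<noteq> []"
    using mr(1) by (auto simp: redexes_def)
  then obtain r' where "n = m @ r'"
    using mr(2) by (metis append_butlast_last_id append.assoc append1_eq_conv)
  then show ?thesis
    using act_redex [OF mr] reduced_prefix assms by simp
next
  case False
  have "\<not> (n @ [g] = a @ r @ b)" if r: "r \<in> redexes T" for a r b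
  proof
    assume *: "n @ [g] = a @ r @ b"
    show False
    proof (cases b rule: rev_cases)
      case Nil
      then show False
        using * r False by auto
    next
      case (snoc b' x)
      then have "n = a @ r @ b'"
        using * by (metis append.assoc append1_eq_conv)
      then show False
        using assms r unfolding reduced_def by blast
    qed
  qed
  moreover have "act T n g = n @ [g]"
    using False act_no_redex by metis
  ultimately show ?thesis
    unfolding reduced_def by simp
qed

lemma reduced_foldl_act: "reduced T n \<Longrightarrow> reduced T (foldl (act T) n w)"
  by (induction w arbitrary: n) (auto intro: reduced_act)

lemma foldl_act_reduced: "reduced T (n @ w) \<Longrightarrow> foldl (act T) n w = n @ w"
proof (induction w rule: rev_induct)
  case (snoc g w)
  then have "foldl (act T) n w = n @ w"
    using reduced_prefix [of T "n @ w" "[g]"] by simp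
  moreover have "act T (n @ w) g = n @ w @ [g]"
    using snoc.prems act_no_redex [of T "n @ w" g] unfolding reduced_def
    by (metis append.assoc append_Nil2)
  ultimately show ?case
    by simp
qed simp

text \<open>Reading a letter can only complete a redex \<open>FInv t # map Letter t\<close>. If this
  happens for the first time after the prefix \<open>q\<close> of \<open>w\<close>, the marker lies
  in \<open>n\<close>, followed there by the rest \<open>a\<close> of \<open>t = a @ q\<close>. The
  hypothesis excludes exactly this.\<close>

lemma foldl_act_Letters:
  assumes "\<And>m a t q. t \<in> T \<Longrightarrow> n = m @ FInv t # map Letter a \<Longrightarrow> t = a @ q \<Longrightarrow> q \<noteq> [] \<Longrightarrow>
      \<not> (\<exists>c. w = q @ c)"
  shows "foldl (act T) n (map Letter w) = n @ map Letter w"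
  using assms
proof (induction w rule: rev_induct)
  case (snoc x w)
  have "foldl (act T) n (map Letter w) = n @ map Letter w"
  proof (rule snoc.IH)
    fix m a t q
    assume "t \<in> T" "n = m @ FInv t # map Letter a" "t = a @ q" "q \<noteq> []"
    then show "\<not> (\<exists>c. w = q @ c)"
      using snoc.prems [of t m a q] by auto
  qed
  moreover have "act T (n @ map Letter w) (Letter x) = (n @ map Letter w) @ [Letter x]"
  proof (rule act_no_redex, rule notI)
    fix m r
    assume r: "r \<in> redexes T" and eq: "(n @ map Letter w) @ [Letter x] = m @ r"
    obtain t where t: "t \<in> T" "r = map Letter t @ [FInv t] \<or> r = FInv t # map Letter t"
      using r unfolding redexes_def by blast
    then have "n @ map Letter (w @ [x]) = m @ FInv t # map Letter t"
      using eq by (auto simp flip: append_assoc)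
    then obtain a where a: "t = a @ (w @ [x])" "n = m @ FInv t # map Letter a"
      using append_Letters_eqD by blast
    show False
      using snoc.prems [OF t(1) a(2,1)] by simp
  qed
  ultimately show ?case
    by simp
qed simp

section \<open>Over an overlap-free set the defining relations act trivially\<close>

lemma overlap_freeD:
  assumes "overlap_free X T" "a @ b \<in> T" "b @ c \<in> T" "b \<noteq> []"
  shows "a = [] \<and> c = []"
proof -
  have "a @ b \<in> lists X" "b @ c \<in> lists X"
    using assms unfolding overlap_free_def by blast+
  then have "a \<in> lists X" "b \<in> lists X" "c \<in> lists X"
    by auto
  moreover have "\<not> overlap X (a @ b) (b @ c)"
    using assms unfolding overlap_free_def by blast
  ultimately show ?thesis
    using assms(4) unfolding overlap_def by blast
qed

lemma foldl_act_FInv_Letters: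
  assumes T: "overlap_free X T" "t \<in> T"
  shows "foldl (act T) (n @ [FInv t]) (map Letter t) = n"
proof -
  have "t \<noteq> []"
    using T unfolding overlap_free_def by blast
  then obtain p x where t: "t = p @ [x]"
    by (cases t rule: rev_cases) auto
  \<comment> \<open>A cancellation before the last letter \<open>x\<close> would complete a redex of
    some \<open>s = a @ q\<close> with \<open>q\<close> a proper prefix of \<open>t\<close>, an
    overlap of \<open>s\<close> and \<open>t\<close>.\<close>
  have "foldl (act T) (n @ [FInv t]) (map Letter p) = (n @ [FInv t]) @ map Letter p"
  proof (rule foldl_act_Letters, rule notI)
    fix m a s q
    assume s: "s \<in> T" "n @ [FInv t] = m @ FInv s # map Letter a" "s = a @ q" "q \<noteq> []"
      and "\<exists>c. p = q @ c"
    then obtain c where "t = q @ c @ [x]"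
      using t by auto
    then show False
      using overlap_freeD [of X T a q "c @ [x]"] T s by auto
  qed
  moreover have "act T ((n @ [FInv t]) @ map Letter p) (Letter x) = n"
    using T(2) t by (intro act_redex [of "FInv t # map Letter t"]) (auto simp: redexes_def)
  ultimately show ?thesis
    by (simp add: t)
qed

text \<open>If \<open>n\<close> ends in \<open>t\<close>, then \<open>FInv t\<close> strips it off
  and the letters put it back, nothing cancelling because \<open>n\<close> is reduced. Otherwise
  \<open>FInv t\<close> is appended and then cancelled by the letters of \<open>t\<close>.\<close>

lemma foldl_act_inverse_left:
  assumes T: "overlap_free X T" "t \<in> T" and n: "reduced T n"
  shows "foldl (act T) n (FInv t # map Letter t) = n"
proof (cases "\<exists>m. n = m @ map Letter t")
  case True
  then obtain m where m: "n = m @ map Letter t"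
    by blast
  have "act T n (FInv t) = m"
    using T(2) m by (intro act_redex [of "map Letter t @ [FInv t]"]) (auto simp: redexes_def)
  then show ?thesis
    using foldl_act_reduced n m by simp
next
  case False
  have "act T n (FInv t) = n @ [FInv t]"
  proof (rule act_no_redex, rule notI)
    fix m r
    assume r: "r \<in> redexes T" and eq: "n @ [FInv t] = m @ r"
    obtain s where s: "s \<in> T" "r = map Letter s @ [FInv s] \<or> r = FInv s # map Letter s"
      using r unfolding redexes_def by blast
    moreover have "s \<noteq> []"
      using s T unfolding overlap_free_def by blast
    ultimately have "r = map Letter s @ [FInv s]"
      using arg_cong [OF eq, of last] by (auto simp: last_map)
    then show False
      using eq False by (auto simp flip: append_assoc)
  qed
  then show ?thesis
    using foldl_act_FInv_Letters [OF T] by simp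
qed

lemma foldl_act_inverse_right:
  assumes T: "overlap_free X T" "t \<in> T" and n: "reduced T n"
  shows "foldl (act T) n (map Letter t @ [FInv t]) = n"
proof (cases "\<exists>m. n = m @ [FInv t]")
  case True
  then obtain m where m: "n = m @ [FInv t]"
    by blast
  have "foldl (act T) n (map Letter t) = m"
    using foldl_act_FInv_Letters [OF T] m by simp
  moreover have "act T m (FInv t) = n"
    using foldl_act_reduced [of T m "[FInv t]"] n m by simp
  ultimately show ?thesis
    by simp
next
  case False
  have "foldl (act T) n (map Letter t) = n @ map Letter t"
  proof (rule foldl_act_Letters, rule notI)
    fix m a s q
    assume s: "s \<in> T" "n = m @ FInv s # map Letter a" "s = a @ q" "q \<noteq> []" and "\<exists>c. t = q @ c"
    then obtain c where c: "t = q @ c"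
      by blast
    \<comment> \<open>Here \<open>q\<close> may be all of \<open>t\<close>, so overlap-freeness
      gives only \<open>s = t\<close> with \<open>a\<close> empty. Then \<open>n\<close> ends in
      \<open>FInv t\<close>, which is the other case.\<close>
    then have "a = [] \<and> c = []"
      using overlap_freeD [of X T a q c] T s by auto
    then show False
      using False s c by simp
  qed
  moreover have "act T (n @ map Letter t) (FInv t) = n"
    using T(2) by (intro act_redex [of "map Letter t @ [FInv t]"]) (auto simp: redexes_def)
  ultimately show ?thesis
    by simp
qed

text \<open>The action descends to the monoid with inverses adjoined. The state varies in the
  induction because the second factor of a product acts on whatever reduced word the first one
  leaves.\<close>

lemma foldl_act_word_cong:
  assumes "(u, v) \<in> word_cong X T" "overlap_free X T" "reduced T n"
  shows "foldl (act T) n u = foldl (act T) n v"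
  using assms
proof (induction arbitrary: n rule: monoid_cong.induct)
  case (rel u v)
  then obtain t where "t \<in> T" "u = map Letter t @ [FInv t] \<or> u = FInv t # map Letter t" "v = []"
    by (auto simp: inv_rels_def)
  then show ?case
    using rel.prems foldl_act_inverse_left foldl_act_inverse_right by force
next
  case (mult u v u' v')
  then show ?case
    using reduced_foldl_act by (metis foldl_append)
qed auto

text \<open>If there were no such \<open>q\<close>, the letters of \<open>u\<close> would pile up
  without cancellation on the reduced word that \<open>y\<close> produces from \<open>[]\<close>.
  But \<open>y @ map Letter u\<close> must take \<open>[]\<close> to \<open>[]\<close>.\<close>

lemma left_invertible_in_overlap_free:
  assumes T: "overlap_free X T" and u: "u \<in> lists X" "u \<noteq> []" "left_invertible_in X T u"
  shows "\<exists>a q c. q \<noteq> [] \<and> a @ q \<in> T \<and> u = q @ c"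
proof (rule ccontr)
  assume contra: "\<nexists>a q c. q \<noteq> [] \<and> a @ q \<in> T \<and> u = q @ c"
  obtain y where y: "(y @ map Letter u, []) \<in> word_cong X T"
    using u by (auto simp: left_invertible_in_iff)
  have "reduced T []"
    by (auto simp: reduced_def redexes_def)
  then have "foldl (act T) (foldl (act T) [] y) (map Letter u) = []"
    using foldl_act_word_cong [OF y T] by simp
  moreover have "foldl (act T) (foldl (act T) [] y) (map Letter u)
      = foldl (act T) [] y @ map Letter u"
    using contra by (intro foldl_act_Letters) blast
  ultimately show False
    using u by simp
qed

section \<open>Uniqueness\<close>

lemma irreducible_invertibles_overlap_free:
  assumes T: "overlap_free X T"
  shows "irreducible_invertibles X T = T"
proof
  have TX: "T \<subseteq> lists X - {[]}"
    using T by (simp add: overlap_free_def)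
  show sub: "T \<subseteq> irreducible_invertibles X T"
  proof
    fix t
    assume t: "t \<in> T"
    have False if uv: "u \<in> lists X - {[]}" "v \<in> lists X - {[]}" "invertible_in X T u" "t = u @ v" for u v
    proof -
      \<comment> \<open>A nonempty prefix \<open>q\<close> of the factor \<open>u\<close> ends an
        element of \<open>T\<close>, which thus overlaps \<open>t = q @ c @ v\<close>, as
        \<open>v\<close> is nonempty.\<close>
      obtain a q c where q: "q \<noteq> []" "a @ q \<in> T" "u = q @ c"
        using left_invertible_in_overlap_free [OF T, of u] uv
        by (auto simp: invertible_in_iff_left_right)
      then show False
        using overlap_freeD [of X T a q "c @ v"] T t uv by auto
    qed
    then show "t \<in> irreducible_invertibles X T"
      using t TX invertible_in_adjoined [of T X t] unfolding irreducible_invertibles_def by blast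
  qed
  show "irreducible_invertibles X T \<subseteq> T"
  proof
    fix w
    assume w: "w \<in> irreducible_invertibles X T"
    then have "w \<in> lists X" "w \<noteq> []" "left_invertible_in X T w"
      by (auto simp: irreducible_invertibles_def invertible_in_iff_left_right)
    then obtain a q c where q: "q \<noteq> []" "a @ q \<in> T" "w = q @ c"
      using left_invertible_in_overlap_free [OF T] by blast
    \<comment> \<open>By the inclusion just proved, \<open>a @ q\<close> and
      \<open>w = q @ c\<close> are both irreducible invertible words, and such words do not
      overlap.\<close>
    then have "a = [] \<and> c = []"
      using irreducible_invertibles_overlap_eq [of a q X T c] sub w by auto
    then show "w \<in> T"
      using q by simp
  qed
qed

text \<open>Existence and uniqueness in one equivalence. An overlap-free \<open>T\<close> is its own
  set of irreducible invertible words, and inverse-equivalence identifies that set with the one of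
  \<open>S\<close>.\<close>

lemma overlap_free_inverse_equivalent_iff:
  assumes "S \<subseteq> lists X"
  shows "overlap_free X T \<and> inverse_equivalent X S T \<longleftrightarrow> T = irreducible_invertibles X S"
proof
  assume T: "overlap_free X T \<and> inverse_equivalent X S T"
  then have "T \<subseteq> lists X"
    by (auto simp: overlap_free_def)
  then show "T = irreducible_invertibles X S"
    using irreducible_invertibles_eq [of S X T] irreducible_invertibles_overlap_free assms T by metis
qed (use assms overlap_free_irreducible_invertibles inverse_equivalent_irreducible_invertibles in auto)

section \<open>The characterizations by one-sided divisors and by finite subsets\<close>

lemma irreducible_invertibles_iff_left:
  assumes "w \<in> lists X - {[]}"
  shows "w \<in> irreducible_invertibles X S \<longleftrightarrow>
    invertible_in X S w \<and> \<not> (\<exists>u. proper_left_divisor X u w \<and> left_invertible_in X S u)"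
proof -
  have "(\<exists>u \<in> lists X - {[]}. \<exists>v \<in> lists X - {[]}.
          invertible_in X S u \<and> invertible_in X S v \<and> w = u @ v) \<longleftrightarrow>
      (\<exists>u. proper_left_divisor X u w \<and> left_invertible_in X S u)" if "invertible_in X S w"
  proof (intro iffI; elim bexE exE conjE)
    fix u v
    assume "u \<in> lists X - {[]}" "v \<in> lists X - {[]}"
      "invertible_in X S u" "invertible_in X S v" "w = u @ v"
    then show "\<exists>u. proper_left_divisor X u w \<and> left_invertible_in X S u"
      unfolding proper_left_divisor_def
      by (intro exI [of _ u] conjI) (auto simp: invertible_in_iff_left_right)
  next
    fix x
    assume "proper_left_divisor X x w" and x: "left_invertible_in X S x"
    then obtain u v where uv: "u \<in> lists X - {[]}" "v \<in> lists X - {[]}" "w = u @ v" "x = u"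
      unfolding proper_left_divisor_def by blast
    then show "\<exists>u \<in> lists X - {[]}. \<exists>v \<in> lists X - {[]}.
        invertible_in X S u \<and> invertible_in X S v \<and> w = u @ v"
      using x that invertible_in_factors_left [of u X v S] by blast
  qed
  then show ?thesis
    using assms unfolding irreducible_invertibles_def by blast
qed

lemma irreducible_invertibles_iff_right:
  assumes "w \<in> lists X - {[]}"
  shows "w \<in> irreducible_invertibles X S \<longleftrightarrow>
    invertible_in X S w \<and> \<not> (\<exists>u. proper_right_divisor X u w \<and> right_invertible_in X S u)"
proof -
  have "(\<exists>u \<in> lists X - {[]}. \<exists>v \<in> lists X - {[]}.
          invertible_in X S u \<and> invertible_in X S v \<and> w = u @ v) \<longleftrightarrow>
      (\<exists>u. proper_right_divisor X u w \<and> right_invertible_in X S u)" if "invertible_in X S w"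
  proof (intro iffI; elim bexE exE conjE)
    fix u v
    assume "u \<in> lists X - {[]}" "v \<in> lists X - {[]}"
      "invertible_in X S u" "invertible_in X S v" "w = u @ v"
    then show "\<exists>u. proper_right_divisor X u w \<and> right_invertible_in X S u"
      unfolding proper_right_divisor_def
      by (intro exI [of _ v] conjI) (auto simp: invertible_in_iff_left_right)
  next
    fix x
    assume "proper_right_divisor X x w" and x: "right_invertible_in X S x"
    then obtain u v where uv: "u \<in> lists X - {[]}" "v \<in> lists X - {[]}" "w = u @ v" "x = v"
      unfolding proper_right_divisor_def by blast
    then show "\<exists>u \<in> lists X - {[]}. \<exists>v \<in> lists X - {[]}.
        invertible_in X S u \<and> invertible_in X S v \<and> w = u @ v"
      using x that invertible_in_factors_right [of u X v S] by blast
  qed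
  then show ?thesis
    using assms unfolding irreducible_invertibles_def by blast
qed

lemma irreducible_invertibles_iff_finite:
  assumes S: "S \<subseteq> lists X" and w: "w \<in> lists X - {[]}"
  shows "w \<in> irreducible_invertibles X S \<longleftrightarrow>
    (\<exists>S'. finite S' \<and> S' \<subseteq> S \<and>
      (\<forall>S''. finite S'' \<and> S' \<subseteq> S'' \<and> S'' \<subseteq> S \<longrightarrow> w \<in> irreducible_invertibles X S''))"
    (is "?L \<longleftrightarrow> ?R")
proof
  assume L: ?L
  then obtain F where F: "finite F" "F \<subseteq> S" "invertible_in X F w"
    using w invertible_in_finite [of w X S] unfolding irreducible_invertibles_def by blast
  have "w \<in> irreducible_invertibles X S''" if "F \<subseteq> S''" "S'' \<subseteq> S" for S''
  proof -
    have "invertible_in X S'' w"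
      using invertible_in_mono [of w X F S''] that F w S by auto
    \<comment> \<open>A factorization of \<open>w\<close> into words invertible over
      \<open>S''\<close> would be one over \<open>S\<close> as well.\<close>
    moreover have "invertible_in X S u" if "u \<in> lists X" "invertible_in X S'' u" for u
      using invertible_in_mono [of u X S'' S] that \<open>S'' \<subseteq> S\<close> S by blast
    ultimately show ?thesis
      using L unfolding irreducible_invertibles_def by blast
  qed
  then show ?R
    using F(1,2) by (intro exI [of _ F]) simp
next
  assume ?R
  then obtain F where F: "finite F" "F \<subseteq> S"
      "\<forall>S''. finite S'' \<and> F \<subseteq> S'' \<and> S'' \<subseteq> S \<longrightarrow> w \<in> irreducible_invertibles X S''"
    by (elim exE conjE)
  have "w \<in> irreducible_invertibles X F"
    using F(1,2) by (intro F(3) [rule_format]) auto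
  then have "invertible_in X F w"
    by (simp add: irreducible_invertibles_def)
  then have inv: "invertible_in X S w"
    using invertible_in_mono [of w X F S] F w S by auto
  have False if uv: "u \<in> lists X - {[]}" "v \<in> lists X - {[]}"
      "invertible_in X S u" "invertible_in X S v" "w = u @ v" for u v
  proof -
    obtain G where G: "finite G" "G \<subseteq> S" "invertible_in X G u"
      using invertible_in_finite [of u X S] uv by blast
    obtain H where H: "finite H" "H \<subseteq> S" "invertible_in X H v"
      using invertible_in_finite [of v X S] uv by blast
    \<comment> \<open>A finite set above \<open>F\<close> over which both factors are already
      invertible, contradicting the irreducibility of \<open>w\<close> there.\<close>
    let ?F = "F \<union> G \<union> H"
    have FS: "?F \<subseteq> S"
      using F G H by blast
    then have "invertible_in X ?F u" "invertible_in X ?F v"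
      using invertible_in_mono [of u X G ?F] invertible_in_mono [of v X H ?F] uv G H S by blast+
    moreover have "w \<in> irreducible_invertibles X ?F"
      using F(1) G(1) H(1) FS by (intro F(3) [rule_format]) auto
    ultimately show False
      using uv irreducible_invertiblesD [of w X ?F u v] by blast
  qed
  then show ?L
    using inv w unfolding irreducible_invertibles_def by auto
qed

theorem proposition5p4:
  fixes X :: "'a set" and S :: "'a list set"
  assumes "S \<subseteq> lists X"
  shows "(\<exists>!T. overlap_free X T \<and> inverse_equivalent X S T) \<and>
    (\<forall>T. overlap_free X T \<and> inverse_equivalent X S T \<longrightarrow>
      (\<forall>w \<in> lists X - {[]}.
        (w \<in> T \<longleftrightarrow>
          invertible_in X S w \<and>
          \<not> (\<exists>u \<in> lists X - {[]}. \<exists>v \<in> lists X - {[]}.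
               invertible_in X S u \<and> invertible_in X S v \<and> w = u @ v)) \<and>
        (w \<in> T \<longleftrightarrow>
          invertible_in X S w \<and>
          \<not> (\<exists>u. proper_left_divisor X u w \<and> left_invertible_in X S u)) \<and>
        (w \<in> T \<longleftrightarrow>
          invertible_in X S w \<and>
          \<not> (\<exists>u. proper_right_divisor X u w \<and> right_invertible_in X S u)) \<and>
        (w \<in> T \<longleftrightarrow>
          (\<exists>S'. finite S' \<and> S' \<subseteq> S \<and>
            (\<forall>S''. finite S'' \<and> S' \<subseteq> S'' \<and> S'' \<subseteq> S \<longrightarrow>
              w \<in> (THE T''. overlap_free X T'' \<and> inverse_equivalent X S'' T''))))))"
proof -
  \<comment> \<open>Stated for every subset of \<open>S\<close>: it is applied to \<open>S\<close>
    itself and, inside the \<open>THE\<close>, to each \<open>S''\<close>.\<close>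
  have iff: "overlap_free X T \<and> inverse_equivalent X R T \<longleftrightarrow> T = irreducible_invertibles X R"
    if "R \<subseteq> S" for R T
    using overlap_free_inverse_equivalent_iff [of R X T] assms that by blast
  have finite_iff: "w \<in> irreducible_invertibles X S \<longleftrightarrow>
      (\<exists>S'. finite S' \<and> S' \<subseteq> S \<and>
        (\<forall>S''. finite S'' \<and> S' \<subseteq> S'' \<and> S'' \<subseteq> S \<longrightarrow>
          w \<in> (THE T''. overlap_free X T'' \<and> inverse_equivalent X S'' T'')))"
    if "w \<in> lists X - {[]}" for w
    unfolding irreducible_invertibles_iff_finite [OF assms that]
    \<comment> \<open>The congruence rules make \<open>S'' \<subseteq> S\<close> available, under
      which \<open>iff\<close> evaluates the description.\<close>
    by (intro ex_cong1 conj_cong HOL.refl all_cong1 imp_cong) (simp add: iff)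
  show ?thesis
    unfolding iff [OF subset_refl]
  proof (intro conjI allI impI ballI; (elim ssubst)?)
    show "\<exists>!T. T = irreducible_invertibles X S"
      by simp
    fix w
    assume w: "w \<in> lists X - {[]}"
    show "w \<in> irreducible_invertibles X S \<longleftrightarrow>
        invertible_in X S w \<and>
        \<not> (\<exists>u \<in> lists X - {[]}. \<exists>v \<in> lists X - {[]}.
             invertible_in X S u \<and> invertible_in X S v \<and> w = u @ v)"
      using w by (simp add: irreducible_invertibles_def)
  qed (fact irreducible_invertibles_iff_left irreducible_invertibles_iff_right finite_iff)+
qed

end
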